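(* Let $F:\mathbb R^n\to\mathbb R$ be twice continuously differentiable. Assume that $\beta_{\rm hb}=\beta_{\rm hb}(\sqrt{s})$ is a smooth function of $\sqrt{s}$ such that $\lim_{s\to0}\beta_{\rm hb}(\sqrt{s})=1$. Consider the heavy-ball iteration $$x_{k+1}=x_k+\beta_{\rm hb}(x_k-x_{k-1})-s\nabla F(x_k)$$ together with its equivalent template $X_{k+1}=\Phi_{\rm HB}(X_k,\sqrt{s})$, where $X_k=(x_k,v_k)$, $v_k=(x_k-x_{k-1})/\sqrt{s}$ and, for $X=(x,v)\in\mathbb R^n\times\mathbb R^n$, $$\Phi_{\rm HB}(X,\sqrt{s})=\begin{bmatrix}x+\sqrt{s}\left[\beta_{\rm hb}v-\sqrt{s}\nabla F(x)\right]\\ \beta_{\rm hb}v-\sqrt{s}\nabla F(x)\end{bmatrix}.$$ Then the $O(\sqrt{s})$-resolution ODE of the iteration with respect to this template is $$\begin{bmatrix} x \\ v \end{bmatrix}'=\begin{bmatrix}v\\ \beta_{\rm hb}'(0)v-\nabla F(x)\end{bmatrix}+\frac{\sqrt{s}}{2}\begin{bmatrix}\beta_{\rm hb}'(0)v-\nabla F(x)\\ \left(\beta_{\rm hb}''(0)-[\beta_{\rm hb}'(0)]^2\right)v+\nabla^2F(x)v+\beta_{\rm hb}'(0)\nabla F(x)\end{bmatrix}.$$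
   Context: $\beta_{\rm hb}(\tau)$ denotes the momentum parameter as a function of $\tau=\sqrt{s}$, and $\beta_{\rm hb}',\beta_{\rm hb}''$ are derivatives in $\tau$. Definition: given a template $X^+=\Phi(X,\sqrt{s})$ with $\Phi(X,0)=X$ for all $X$, an ODE $X'(t)=\Gamma_0(X(t))+\sqrt{s}\,\Gamma_1(X(t))$, $X(0)=X$, with $\Gamma_0,\Gamma_1$ independent of $s$, is the $O(\sqrt{s})$-resolution ODE with respect to the template if for every $X$ its solution satisfies $\|X(\sqrt{s})-X^+\|=o\big((\sqrt{s})^{2}\big)=o(s)$ as $s\to0^+$. *)

theory Defs
  imports "HOL-Analysis.Analysis" "HOL-Library.Landau_Symbols"
begin

definition gradient :: "('a::real_inner \<Rightarrow> real) \<Rightarrow> 'a \<Rightarrow> 'a" where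
  "gradient F x = (THE g. GDERIV F x :> g)"

definition hessian :: "(real ^ 'n \<Rightarrow> real) \<Rightarrow> real ^ 'n \<Rightarrow> real ^ 'n ^ 'n" where
  "hessian F x = jacobian (gradient F) (at x)"

definition twice_continuously_differentiable :: "(real ^ 'n \<Rightarrow> real) \<Rightarrow> bool" where
  "twice_continuously_differentiable F \<longleftrightarrow>
     (\<forall>x. F differentiable (at x)) \<and>
     (\<forall>x. gradient F differentiable (at x)) \<and>
     continuous_on UNIV (hessian F)"

text \<open>
  Derivatives are taken relative to a set \<open>S\<close>, so that for \<open>S = {0..<\<tau>\<^sub>0}\<close> the derivatives at 0 are
  one-sided: the momentum parameter is only given for nonnegative values of \<open>\<tau> = sqrt s\<close>.
\<close>

primrec higher_deriv_within :: "real set \<Rightarrow> (real \<Rightarrow> real) \<Rightarrow> nat \<Rightarrow> real \<Rightarrow> real" where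
  "higher_deriv_within S f 0 = f"
| "higher_deriv_within S f (Suc n) =
     (\<lambda>t. vector_derivative (higher_deriv_within S f n) (at t within S))"

definition smooth_within :: "real set \<Rightarrow> (real \<Rightarrow> real) \<Rightarrow> bool" where
  "smooth_within S f \<longleftrightarrow>
     (\<forall>n. \<forall>t\<in>S. higher_deriv_within S f n differentiable (at t within S))"

definition heavy_ball_iteration ::
    "(real \<Rightarrow> real) \<Rightarrow> (real ^ 'n \<Rightarrow> real) \<Rightarrow> real \<Rightarrow> (nat \<Rightarrow> real ^ 'n) \<Rightarrow> bool" where
  "heavy_ball_iteration \<beta> F s x \<longleftrightarrow>
     (\<forall>k\<ge>1. x (k + 1) = x k + \<beta> (sqrt s) *\<^sub>R (x k - x (k - 1)) - s *\<^sub>R gradient F (x k))"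

text \<open>The pair of position and scaled velocity; meaningful for \<open>k \<ge> 1\<close> only.\<close>

definition heavy_ball_state ::
    "real \<Rightarrow> (nat \<Rightarrow> real ^ 'n) \<Rightarrow> nat \<Rightarrow> (real ^ 'n) \<times> (real ^ 'n)" where
  "heavy_ball_state s x k = (x k, (x k - x (k - 1)) /\<^sub>R sqrt s)"

definition heavy_ball_template ::
    "(real \<Rightarrow> real) \<Rightarrow> (real ^ 'n \<Rightarrow> real) \<Rightarrow>
     (real ^ 'n) \<times> (real ^ 'n) \<Rightarrow> real \<Rightarrow> (real ^ 'n) \<times> (real ^ 'n)" where
  "heavy_ball_template \<beta> F = (\<lambda>(x, v) \<tau>.
     (x + \<tau> *\<^sub>R (\<beta> \<tau> *\<^sub>R v - \<tau> *\<^sub>R gradient F x),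
      \<beta> \<tau> *\<^sub>R v - \<tau> *\<^sub>R gradient F x))"

definition ode_solution ::
    "('a::real_normed_vector \<Rightarrow> 'a) \<Rightarrow> ('a \<Rightarrow> 'a) \<Rightarrow> real \<Rightarrow> 'a \<Rightarrow> (real \<Rightarrow> 'a) \<Rightarrow> bool" where
  "ode_solution \<Gamma>\<^sub>0 \<Gamma>\<^sub>1 s X\<^sub>0 X \<longleftrightarrow>
     X 0 = X\<^sub>0 \<and>
     (\<forall>t\<in>{0..sqrt s}.
        (X has_vector_derivative \<Gamma>\<^sub>0 (X t) + sqrt s *\<^sub>R \<Gamma>\<^sub>1 (X t)) (at t within {0..sqrt s}))"

text \<open>
  The vector fields need not be Lipschitz, so solutions may be non-unique and need not be global.
  Hence a solution on \<open>[0, sqrt s]\<close> is required to exist for all small \<open>s > 0\<close>, and the error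
  estimate is required of every choice \<open>X s\<close> of such solutions.
\<close>

definition sqrt_s_resolution_ode ::
    "('a::real_normed_vector \<Rightarrow> real \<Rightarrow> 'a) \<Rightarrow> ('a \<Rightarrow> 'a) \<Rightarrow> ('a \<Rightarrow> 'a) \<Rightarrow> bool" where
  "sqrt_s_resolution_ode \<Phi> \<Gamma>\<^sub>0 \<Gamma>\<^sub>1 \<longleftrightarrow>
     (\<forall>X\<^sub>0. \<Phi> X\<^sub>0 0 = X\<^sub>0) \<and>
     (\<forall>X\<^sub>0.
        (\<forall>\<^sub>F s in at_right 0. \<exists>X. ode_solution \<Gamma>\<^sub>0 \<Gamma>\<^sub>1 s X\<^sub>0 X) \<and>
        (\<forall>X. (\<forall>\<^sub>F s in at_right 0. ode_solution \<Gamma>\<^sub>0 \<Gamma>\<^sub>1 s X\<^sub>0 (X s)) \<longrightarrow>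
           (\<lambda>s. norm (X s (sqrt s) - \<Phi> X\<^sub>0 (sqrt s))) \<in> o[at_right 0](\<lambda>s. s)))"

end

theory Submission imports Defs "HOL-Complex_Analysis.Great_Picard" begin

text \<open>
  With \<open>\<tau> = sqrt s\<close>, two applications of the mean value inequality show that every solution satisfies
  \<open>X(\<tau>) = X\<^sub>0 + \<tau> \<Gamma>\<^sub>0(X\<^sub>0) + \<tau>\<^sup>2 (D\<Gamma>\<^sub>0(X\<^sub>0) \<Gamma>\<^sub>0(X\<^sub>0) / 2 + \<Gamma>\<^sub>1(X\<^sub>0)) + o(\<tau>\<^sup>2)\<close>; this only needs \<open>\<Gamma>\<^sub>0\<close> differentiable and
  \<open>\<Gamma>\<^sub>1\<close> continuous at \<open>X\<^sub>0\<close>. The second-order Taylor polynomial of \<open>\<beta>\<close> at 0 gives the same expansion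
  for the template. Since the Hessian is merely continuous, solutions are obtained from Peano's
  theorem, by Tonelli's delayed equations and the Arzela-Ascoli theorem.
\<close>

section \<open>Mean value inequality and a priori bound for solutions\<close>

lemma norm_diff_le_of_vector_derivative_bound:
  fixes g :: "real \<Rightarrow> 'a::real_normed_vector"
  assumes "0 \<le> T"
    and der: "\<And>t. t \<in> {0..T} \<Longrightarrow> (g has_vector_derivative g' t) (at t within {0..T})"
    and bnd: "\<And>t. 0 < t \<Longrightarrow> t < T \<Longrightarrow> norm (g' t) \<le> B"
  shows "norm (g T - g 0) \<le> B * T"
proof (cases "T = 0")
  case False
  with \<open>0 \<le> T\<close> have "0 < T" by simp
  have "norm (g T - g 0) \<le> B * T - B * 0"
  proof (rule differentiable_bound_general[OF \<open>0 < T\<close>])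
    show "continuous_on {0..T} g"
      using der has_vector_derivative_continuous continuous_on_eq_continuous_within by blast
    show "(g has_vector_derivative g' x) (at x)" if "0 < x" "x < T" for x
      using der[of x] that at_within_Icc_at[of 0 x T] by simp
    show "((\<lambda>t. B * t) has_vector_derivative B) (at x)" for x
      by (auto intro!: derivative_eq_intros simp: has_real_derivative_iff_has_vector_derivative[symmetric])
  qed (auto intro!: continuous_intros bnd)
  then show ?thesis by simp
qed simp

text \<open>First-exit argument: before the first time at which distance \<open>r\<close> is
  reached, the solution stays where the speed is at most \<open>M\<close>. At that time it would
  therefore have travelled at most \<open>M * T < r\<close>, a contradiction, so the speed bound is
  available on the whole interval.\<close>

lemma ode_a_priori_bound:
  fixes f :: "'a::real_normed_vector \<Rightarrow> 'a"
  assumes "X 0 = x\<^sub>0"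
    and ode: "\<And>t. t \<in> {0..T} \<Longrightarrow> (X has_vector_derivative f (X t)) (at t within {0..T})"
    and bnd: "\<And>y. dist x\<^sub>0 y \<le> r \<Longrightarrow> norm (f y) \<le> M"
    and "0 \<le> M" "0 < r" "M * T < r"
    and t: "t \<in> {0..T}"
  shows "norm (X t - x\<^sub>0) \<le> M * t"
proof -
  have ode': "(X has_vector_derivative f (X t)) (at t within {0..u})"
    if "t \<in> {0..u}" "u \<in> {0..T}" for t u
    using ode[of t] that by (auto intro: has_vector_derivative_within_subset)
  \<comment> \<open>The mean value inequality asks for the speed bound only at interior times, so
    nothing is assumed about the position at \<open>u\<close> itself; this allows \<open>u\<close>
    to be the exit time below.\<close>
  have bound_of: "norm (X u - x\<^sub>0) \<le> M * u"
    if u: "u \<in> {0..T}" and in_ball: "\<And>t. 0 < t \<Longrightarrow> t < u \<Longrightarrow> dist x\<^sub>0 (X t) \<le> r" for u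
    using norm_diff_le_of_vector_derivative_bound[of u X "\<lambda>t. f (X t)" M] ode' u bnd[OF in_ball]
      \<open>X 0 = x\<^sub>0\<close> by auto
  have cont: "continuous_on {0..T} X"
    using ode has_vector_derivative_continuous continuous_on_eq_continuous_within by blast
  \<comment> \<open>\<open>A\<close> collects the times at distance at least \<open>r\<close>. It is
    compact by continuity of \<open>X\<close>, so if it is nonempty its least element is the first
    exit time.\<close>
  define A where "A = {t \<in> {0..T}. r \<le> dist x\<^sub>0 (X t)}"
  have "A = {}"
  proof (rule ccontr)
    assume "A \<noteq> {}"
    have "closed ({0..T} \<inter> (\<lambda>t. dist x\<^sub>0 (X t)) -` {r..})"
      by (intro continuous_closed_preimage continuous_intros cont)
    moreover have "{0..T} \<inter> (\<lambda>t. dist x\<^sub>0 (X t)) -` {r..} = A" "{0..T} \<inter> A = A"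
      by (auto simp: A_def)
    ultimately have "compact A"
      using compact_Int_closed[OF compact_Icc, of A 0 T] by simp
    then obtain u where u: "u \<in> A" and least: "\<And>t. t \<in> A \<Longrightarrow> u \<le> t"
      using compact_attains_inf[OF _ \<open>A \<noteq> {}\<close>] by blast
    have "dist x\<^sub>0 (X t) \<le> r" if "0 < t" "t < u" for t
    proof (rule ccontr)
      assume "\<not> dist x\<^sub>0 (X t) \<le> r"
      with that u have "t \<in> A" by (auto simp: A_def)
      with least that show False by fastforce
    qed
    then have "norm (X u - x\<^sub>0) \<le> M * u"
      using u by (intro bound_of) (auto simp: A_def)
    also have "\<dots> \<le> M * T"
      using u \<open>0 \<le> M\<close> by (auto simp: A_def intro: mult_left_mono)
    also have "\<dots> < r" by fact
    finally show False
      using u by (simp add: A_def dist_norm norm_minus_commute)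
  qed
  show ?thesis
  proof (intro bound_of t)
    fix u assume "0 < u" "u < t"
    then have "u \<in> {0..T}" using t by auto
    with \<open>A = {}\<close> show "dist x\<^sub>0 (X u) \<le> r" by (fastforce simp: A_def)
  qed
qed


section \<open>Peano's existence theorem\<close>

text \<open>The global bound \<open>M\<close> makes every approximating curve
  \<open>M\<close>-Lipschitz on all of \<open>[0, T]\<close>. The delayed integral equations can be
  solved exactly, a subsequence of their solutions converges uniformly, and the limit solves the
  integral equation without delay.\<close>

lemma peano_bounded:
  fixes f :: "'a::euclidean_space \<Rightarrow> 'a"
  assumes cont: "continuous_on UNIV f" and bnd: "\<And>y. norm (f y) \<le> M" and "0 \<le> T"
  obtains X where "X 0 = x\<^sub>0" "\<And>t. t \<in> {0..T} \<Longrightarrow> norm (X t - x\<^sub>0) \<le> M * t"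
    "\<And>t. t \<in> {0..T} \<Longrightarrow> (X has_vector_derivative f (X t)) (at t within {0..T})"
proof -
  have M: "0 \<le> M" using bnd[of 0] norm_ge_zero order_trans by blast
  \<comment> \<open>Picard operator with delay \<open>h\<close>: the field is evaluated at the
    position held \<open>h\<close> earlier, and times before 0 are clamped to 0. For
    \<open>h = 0\<close>, fixed points on \<open>[0, T]\<close> are solutions of the original
    integral equation.\<close>
  define P :: "real \<Rightarrow> (real \<Rightarrow> 'a) \<Rightarrow> real \<Rightarrow> 'a"
    where "P = (\<lambda>h Z t. x\<^sub>0 + integral {0..t} (\<lambda>s. f (Z (max 0 (s - h)))))"
  have cont_delay: "continuous_on {0..T} (\<lambda>s. f (Z (max 0 (s - h))))"
    if Z: "continuous_on {0..T} Z" and "0 \<le> h" for Z h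
  proof -
    have "continuous_on {0..T} (\<lambda>s. Z (max 0 (s - h)))"
      by (rule continuous_on_compose2[OF Z]) (use \<open>0 \<le> h\<close> in \<open>auto intro!: continuous_intros\<close>)
    then show ?thesis
      by (rule continuous_on_compose2[OF cont]) auto
  qed
  \<comment> \<open>The Lipschitz constant depends neither on \<open>h\<close> nor on
    \<open>Z\<close>; this is the source of equicontinuity for the whole family.\<close>
  have Lip: "norm (P h Z t - P h Z u) \<le> M * \<bar>t - u\<bar>"
    if Z: "continuous_on {0..T} Z" "0 \<le> h" and "t \<in> {0..T}" "u \<in> {0..T}" for Z h t u
  proof -
    have *: "norm (P h Z t - P h Z u) \<le> M * (t - u)" if "u \<le> t" "0 \<le> u" "t \<le> T" for t u
    proof -
      let ?g = "\<lambda>s. f (Z (max 0 (s - h)))"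
      have "continuous_on {0..t} ?g" "continuous_on {u..t} ?g"
        using that by (auto intro: continuous_on_subset[OF cont_delay[OF Z]])
      then have "P h Z t - P h Z u = integral {u..t} ?g"
        using Henstock_Kurzweil_Integration.integral_combine[of 0 u t ?g] that
          integrable_continuous_real[of 0 t ?g] by (simp add: P_def algebra_simps)
      with integral_bound[OF \<open>u \<le> t\<close> \<open>continuous_on {u..t} ?g\<close>, of M] bnd show ?thesis by simp
    qed
    show ?thesis
      using *[of u t] *[of t u] that by (cases "u \<le> t") (auto simp: norm_minus_commute)
  qed
  have cont_P: "continuous_on {0..T} (P h Z)" if "continuous_on {0..T} Z" "0 \<le> h" for Z h
  proof -
    have "M-lipschitz_on {0..T} (P h Z)"
      using Lip[OF that] M by (auto simp: lipschitz_on_def dist_norm)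
    then show ?thesis by (rule lipschitz_on_continuous_on)
  qed
  \<comment> \<open>The delay makes the Picard iteration stationary on \<open>[0, k h]\<close> after \<open>k\<close> steps.\<close>
  have delayed: "\<exists>Z. continuous_on {0..T} Z \<and> (\<forall>t\<in>{0..T}. Z t = P h Z t)" if "0 < h" for h
  proof -
    define Z where "Z = (\<lambda>k. (P h ^^ k) (\<lambda>_. x\<^sub>0))"
    have cZ: "continuous_on {0..T} (Z k)" for k
      by (induction k) (use \<open>0 < h\<close> in \<open>auto simp: Z_def intro!: cont_P\<close>)
    have stat: "Z (Suc k) t = Z k t" if "t \<in> {0..T}" "t \<le> real k * h" for k t
      using that
    proof (induction k arbitrary: t)
      case 0
      then show ?case by (simp add: Z_def P_def)
    next
      case (Suc k)
      \<comment> \<open>For \<open>s\<close> up to \<open>(k + 1) * h\<close> the delayed time is at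
        most \<open>k * h\<close>, where the previous two iterates already agree.\<close>
      have "Z (Suc k) (max 0 (s - h)) = Z k (max 0 (s - h))" if "s \<in> {0..t}" for s
        using that Suc.prems \<open>0 < h\<close> by (intro Suc.IH) (auto simp: algebra_simps)
      then have "integral {0..t} (\<lambda>s. f (Z (Suc k) (max 0 (s - h))))
          = integral {0..t} (\<lambda>s. f (Z k (max 0 (s - h))))"
        by (intro integral_cong) auto
      then show ?case by (simp add: Z_def P_def)
    qed
    obtain k where "T \<le> real k * h"
      using reals_Archimedean3[OF \<open>0 < h\<close>] less_imp_le by blast
    then have "Z k t = P h (Z k) t" if "t \<in> {0..T}" for t
      using stat[of t k] that by (simp add: Z_def)
    with cZ show ?thesis by blast
  qed
  define h where "h n = inverse (real (Suc n))" for n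
  have h: "0 < h n" for n by (simp add: h_def)
  obtain Y where cY: "\<And>n. continuous_on {0..T} (Y n)"
    and Y: "\<And>n t. t \<in> {0..T} \<Longrightarrow> Y n t = P (h n) (Y n) t"
    using delayed[OF h] by metis
  have LipY: "norm (Y n t - Y n u) \<le> M * \<bar>t - u\<bar>" if "t \<in> {0..T}" "u \<in> {0..T}" for n t u
    using Lip[OF cY less_imp_le[OF h] that] Y that by simp
  have Y0: "Y n 0 = x\<^sub>0" for n using Y[of 0] \<open>0 \<le> T\<close> by (simp add: P_def)
  \<comment> \<open>Arzela-Ascoli: the curves start at \<open>x\<^sub>0\<close> and share the
    Lipschitz constant \<open>M\<close>, hence are uniformly bounded and equicontinuous.\<close>
  obtain X k where cX: "continuous_on {0..T} X" and k: "strict_mono (k :: nat \<Rightarrow> nat)"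
    and unif: "\<And>e. 0 < e \<Longrightarrow> \<exists>N. \<forall>n t. n \<ge> N \<and> t \<in> {0..T} \<longrightarrow> norm (Y (k n) t - X t) < e"
  proof (rule Arzela_Ascoli[of "{0..T}" Y "norm x\<^sub>0 + M * T"])
    show "norm (Y n t) \<le> norm x\<^sub>0 + M * T" if "t \<in> {0..T}" for n t
    proof -
      have "norm (Y n t - x\<^sub>0) \<le> M * t"
        using LipY[of t 0 n] that \<open>0 \<le> T\<close> by (simp add: Y0)
      also have "\<dots> \<le> M * T" using that M by (simp add: mult_left_mono)
      finally show ?thesis using norm_triangle_sub[of "Y n t" x\<^sub>0] by simp
    qed
    show "\<exists>d>0. \<forall>n u. u \<in> {0..T} \<and> norm (t - u) < d \<longrightarrow> norm (Y n t - Y n u) < e"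
      if "t \<in> {0..T}" "0 < e" for t e
    proof (intro exI conjI allI impI)
      \<comment> \<open>\<open>M + 1\<close> replaces \<open>M\<close> in the denominator because
        \<open>M\<close> may be 0.\<close>
      show "0 < e / (M + 1)" using that M by simp
      fix n u assume u: "u \<in> {0..T} \<and> norm (t - u) < e / (M + 1)"
      have "norm (Y n t - Y n u) \<le> M * \<bar>t - u\<bar>" using LipY that u by blast
      also have "\<dots> \<le> (M + 1) * \<bar>t - u\<bar>" by (simp add: mult_right_mono)
      also have "\<dots> < e" using u M by (simp add: field_simps)
      finally show "norm (Y n t - Y n u) < e" .
    qed
  qed auto
  have lim: "(\<lambda>n. Y (k n) t) \<longlonglongrightarrow> X t" if "t \<in> {0..T}" for t
    unfolding LIMSEQ_iff using unif that by blast
  have hk: "(\<lambda>n. h (k n)) \<longlonglongrightarrow> 0"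
    using LIMSEQ_subseq_LIMSEQ[OF LIMSEQ_inverse_real_of_nat k] by (simp add: h_def o_def)
  \<comment> \<open>The delay moves the argument by at most \<open>h (k n)\<close>, which by the
    common Lipschitz constant changes the value by at most \<open>M * h (k n)\<close>, and this
    tends to 0.\<close>
  have lim_delay: "(\<lambda>n. Y (k n) (max 0 (t - h (k n)))) \<longlonglongrightarrow> X t" if t: "t \<in> {0..T}" for t
  proof -
    have "(\<lambda>n. Y (k n) (max 0 (t - h (k n))) - Y (k n) t) \<longlonglongrightarrow> 0"
    proof (rule Lim_null_comparison)
      show "\<forall>\<^sub>F n in sequentially. norm (Y (k n) (max 0 (t - h (k n))) - Y (k n) t) \<le> M * h (k n)"
      proof (rule always_eventually, rule allI)
        fix n
        have "norm (Y (k n) (max 0 (t - h (k n))) - Y (k n) t) \<le> M * \<bar>max 0 (t - h (k n)) - t\<bar>"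
          using t h[of "k n"] by (intro LipY) auto
        also have "\<dots> \<le> M * h (k n)"
          using t h[of "k n"] M by (intro mult_left_mono) auto
        finally show "norm (Y (k n) (max 0 (t - h (k n))) - Y (k n) t) \<le> M * h (k n)" .
      qed
      show "(\<lambda>n. M * h (k n)) \<longlonglongrightarrow> 0" using tendsto_mult_right_zero[OF hk] by simp
    qed
    from tendsto_add[OF this lim[OF t]] show ?thesis by simp
  qed
  \<comment> \<open>Passage to the limit in the delayed equations: the integrands converge pointwise
    by continuity of \<open>f\<close> and are dominated by the constant \<open>M\<close>.\<close>
  have X_eq: "X t = x\<^sub>0 + integral {0..t} (\<lambda>s. f (X s))" if t: "t \<in> {0..T}" for t
  proof (rule LIMSEQ_unique[OF lim[OF t]])
    have "(\<lambda>n. integral {0..t} (\<lambda>s. f (Y (k n) (max 0 (s - h (k n))))))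
        \<longlonglongrightarrow> integral {0..t} (\<lambda>s. f (X s))"
    proof (rule dominated_convergence(2))
      show "(\<lambda>s. f (Y (k n) (max 0 (s - h (k n))))) integrable_on {0..t}" for n
        using t h[of "k n"]
        by (intro integrable_continuous_real continuous_on_subset[OF cont_delay[OF cY]])
          (auto intro: less_imp_le)
      show "(\<lambda>_. M) integrable_on {0..t}" by (rule integrable_const_ivl)
      show "(\<lambda>n. f (Y (k n) (max 0 (s - h (k n))))) \<longlonglongrightarrow> f (X s)" if "s \<in> {0..t}" for s
        using that t by (intro continuous_on_tendsto_compose[OF cont] lim_delay) auto
    qed (rule bnd)
    then show "(\<lambda>n. Y (k n) t) \<longlonglongrightarrow> x\<^sub>0 + integral {0..t} (\<lambda>s. f (X s))"
      by (subst Y[OF t]) (auto simp: P_def intro: tendsto_add)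
  qed
  have cfX: "continuous_on {0..T} (\<lambda>s. f (X s))"
    by (rule continuous_on_compose2[OF cont cX]) auto
  show ?thesis
  proof
    show "X 0 = x\<^sub>0" using X_eq[of 0] \<open>0 \<le> T\<close> by simp
    show "norm (X t - x\<^sub>0) \<le> M * t" if "t \<in> {0..T}" for t
      using integral_bound[of 0 t "\<lambda>s. f (X s)" M] bnd that X_eq[OF that]
        continuous_on_subset[OF cfX, of "{0..t}"] by simp
    show "(X has_vector_derivative f (X t)) (at t within {0..T})" if t: "t \<in> {0..T}" for t
    proof (rule has_vector_derivative_transform[OF t X_eq])
      show "((\<lambda>t. x\<^sub>0 + integral {0..t} (\<lambda>s. f (X s))) has_vector_derivative f (X t))
          (at t within {0..T})"
        using has_vector_derivative_add[OF has_vector_derivative_const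
            integral_has_vector_derivative[OF cfX t]] by simp
    qed
  qed
qed

text \<open>Composing \<open>f\<close> with the nearest-point projection onto the ball gives a
  continuous field bounded by \<open>M\<close> on the whole space. Its solution travels at most
  \<open>M * T \<le> r\<close>, so it stays in the ball, where the projection is the
  identity.\<close>

lemma peano_ball:
  fixes f :: "'a::euclidean_space \<Rightarrow> 'a"
  assumes cont: "continuous_on (cball x\<^sub>0 r) f" and bnd: "\<And>y. y \<in> cball x\<^sub>0 r \<Longrightarrow> norm (f y) \<le> M"
    and "0 \<le> r" "0 \<le> T" "M * T \<le> r"
  obtains X where "X 0 = x\<^sub>0"
    "\<And>t. t \<in> {0..T} \<Longrightarrow> (X has_vector_derivative f (X t)) (at t within {0..T})"
proof -
  let ?p = "closest_point (cball x\<^sub>0 r)"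
  have p: "?p y \<in> cball x\<^sub>0 r" for y
    using \<open>0 \<le> r\<close> by (intro closest_point_in_set) auto
  have M: "0 \<le> M" using bnd[of x\<^sub>0] \<open>0 \<le> r\<close> norm_ge_zero[of "f x\<^sub>0"]
    by (metis centre_in_cball order_trans)
  have "continuous_on UNIV (\<lambda>y. f (?p y))"
    using \<open>0 \<le> r\<close> p
    by (intro continuous_on_compose2[OF cont] continuous_on_closest_point) auto
  then obtain X where X: "X 0 = x\<^sub>0" "\<And>t. t \<in> {0..T} \<Longrightarrow> norm (X t - x\<^sub>0) \<le> M * t"
    "\<And>t. t \<in> {0..T} \<Longrightarrow> (X has_vector_derivative f (?p (X t))) (at t within {0..T})"
    using peano_bounded[of "\<lambda>y. f (?p y)" M T x\<^sub>0] bnd[OF p] \<open>0 \<le> T\<close> by metis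
  have "?p (X t) = X t" if "t \<in> {0..T}" for t
  proof (rule closest_point_self)
    have "norm (X t - x\<^sub>0) \<le> M * T"
      using X(2)[OF that] mult_left_mono[OF _ M, of t T] that by auto
    then show "X t \<in> cball x\<^sub>0 r"
      using \<open>M * T \<le> r\<close> by (simp add: dist_norm norm_minus_commute)
  qed
  with X show ?thesis by (intro that[of X]) auto
qed


section \<open>One-sided limits and Taylor expansion at 0\<close>

lemma filterlim_sqrt_at_right_0: "filterlim sqrt (at_right 0) (at_right 0)"
proof -
  have "(sqrt \<longlongrightarrow> sqrt 0) (at_right 0)" by (intro tendsto_intros)
  then show ?thesis
    by (auto simp: filterlim_at intro: eventually_at_rightI[of 0 1])
qed

lemma eventually_sqrt_less:
  assumes "0 < \<delta>"
  shows "\<forall>\<^sub>F s in at_right 0. 0 < sqrt s \<and> sqrt s < \<delta>"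
proof (rule eventually_compose_filterlim[OF _ filterlim_sqrt_at_right_0])
  show "\<forall>\<^sub>F \<tau> in at_right 0. 0 < \<tau> \<and> \<tau> < \<delta>"
    using assms by (intro eventually_at_rightI[of 0 \<delta>]) auto
qed

lemma continuous_on_matrix_vector_mult:
  fixes A :: "'b::topological_space \<Rightarrow> real ^ 'n ^ 'm" and f :: "'b \<Rightarrow> real ^ 'n"
  assumes "continuous_on S A" "continuous_on S f"
  shows "continuous_on S (\<lambda>x. A x *v f x)"
  unfolding matrix_vector_mult_def using assms by (intro continuous_intros)

text \<open>Peano form of the remainder with one-sided derivatives: \<open>f\<close> minus its
  quadratic polynomial has derivative \<open>f' t - f' 0 - t * c\<close>, which is small compared
  with \<open>t\<close> by differentiability of \<open>f'\<close> at 0.\<close>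

lemma taylor_2_at_right_0:
  fixes f :: "real \<Rightarrow> real"
  assumes "0 < \<tau>\<^sub>0"
    and f: "\<And>t. t \<in> {0..<\<tau>\<^sub>0} \<Longrightarrow> (f has_vector_derivative f' t) (at t within {0..<\<tau>\<^sub>0})"
    and f': "(f' has_vector_derivative c) (at 0 within {0..<\<tau>\<^sub>0})"
    and "0 < e"
  shows "\<forall>\<^sub>F \<tau> in at_right 0. \<bar>f \<tau> - (f 0 + \<tau> * f' 0 + \<tau>\<^sup>2 / 2 * c)\<bar> \<le> e * \<tau>\<^sup>2"
proof -
  obtain d where "0 < d"
    and d': "\<forall>t\<in>{0..<\<tau>\<^sub>0}. norm (t - 0) < d \<longrightarrow>
      norm (f' t - f' 0 - (t - 0) *\<^sub>R c) \<le> e * norm (t - 0)"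
    using f' \<open>0 < e\<close> unfolding has_vector_derivative_def has_derivative_within_alt by blast
  have d: "\<bar>f' t - f' 0 - t * c\<bar> \<le> e * \<bar>t\<bar>" if "t \<in> {0..<\<tau>\<^sub>0}" "\<bar>t\<bar> < d" for t
    using bspec[OF d' that(1)] that(2) by simp
  have "\<bar>f \<tau> - (f 0 + \<tau> * f' 0 + \<tau>\<^sup>2 / 2 * c)\<bar> \<le> e * \<tau>\<^sup>2" if \<tau>: "0 < \<tau>" "\<tau> < min d \<tau>\<^sub>0" for \<tau>
  proof -
    \<comment> \<open>On \<open>[0, \<tau>]\<close> the derivative of \<open>?g\<close> is bounded
      by \<open>e * \<tau>\<close>; the length of the interval supplies the second factor
      \<open>\<tau>\<close>.\<close>
    let ?g = "\<lambda>t. f t - (t * f' 0 + t\<^sup>2 / 2 * c)"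
    have "norm (?g \<tau> - ?g 0) \<le> (e * \<tau>) * \<tau>"
    proof (rule norm_diff_le_of_vector_derivative_bound)
      fix t assume t: "t \<in> {0..\<tau>}"
      then have "(f has_vector_derivative f' t) (at t within {0..\<tau>})"
        using \<tau> by (intro has_vector_derivative_within_subset[OF f]) auto
      moreover have "((\<lambda>t. t * f' 0 + t\<^sup>2 / 2 * c) has_vector_derivative f' 0 + t * c)
          (at t within {0..\<tau>})"
        unfolding has_real_derivative_iff_has_vector_derivative[symmetric]
        by (auto intro!: derivative_eq_intros)
      ultimately show "(?g has_vector_derivative f' t - (f' 0 + t * c)) (at t within {0..\<tau>})"
        by (rule has_vector_derivative_diff)
    next
      fix t assume t: "0 < t" "t < \<tau>"
      then have "\<bar>f' t - f' 0 - t * c\<bar> \<le> e * \<bar>t\<bar>"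
        using \<tau> by (intro d) auto
      also have "\<dots> \<le> e * \<tau>" using t \<open>0 < e\<close> by simp
      finally show "norm (f' t - (f' 0 + t * c)) \<le> e * \<tau>" by (simp add: algebra_simps)
    qed (use \<tau> in simp)
    then show ?thesis by (simp add: power2_eq_square algebra_simps)
  qed
  then show ?thesis
    using \<open>0 < d\<close> \<open>0 < \<tau>\<^sub>0\<close> by (intro eventually_at_rightI[of 0 "min d \<tau>\<^sub>0"]) auto
qed

section \<open>Existence and second-order expansion of solutions\<close>

text \<open>On the unit ball around \<open>X\<^sub>0\<close> the field is bounded by
  \<open>M\<^sub>0 + M\<^sub>1\<close> as soon as \<open>sqrt s \<le> 1\<close>. The time span
  \<open>sqrt s\<close> is then taken too short to leave this ball, so the local Peano theorem
  covers all of \<open>[0, sqrt s]\<close>.\<close>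

lemma eventually_ode_solution_exists:
  fixes \<Gamma>\<^sub>0 \<Gamma>\<^sub>1 :: "'a::euclidean_space \<Rightarrow> 'a"
  assumes "continuous_on UNIV \<Gamma>\<^sub>0" "continuous_on UNIV \<Gamma>\<^sub>1"
  shows "\<forall>\<^sub>F s in at_right 0. \<exists>X. ode_solution \<Gamma>\<^sub>0 \<Gamma>\<^sub>1 s X\<^sub>0 X"
proof -
  have "bounded (\<Gamma>\<^sub>0 ` cball X\<^sub>0 1)" "bounded (\<Gamma>\<^sub>1 ` cball X\<^sub>0 1)"
    using assms by (auto intro!: compact_imp_bounded compact_continuous_image
        intro: continuous_on_subset)
  then obtain M\<^sub>0 M\<^sub>1 where M: "\<forall>y\<in>cball X\<^sub>0 1. norm (\<Gamma>\<^sub>0 y) \<le> M\<^sub>0"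
      "\<forall>y\<in>cball X\<^sub>0 1. norm (\<Gamma>\<^sub>1 y) \<le> M\<^sub>1" "0 < M\<^sub>0" "0 < M\<^sub>1"
    unfolding bounded_pos ball_simps by blast
  have "\<exists>X. ode_solution \<Gamma>\<^sub>0 \<Gamma>\<^sub>1 s X\<^sub>0 X"
    if s: "0 < sqrt s" "sqrt s < min 1 (1 / (M\<^sub>0 + M\<^sub>1))" for s
  proof -
    have "norm (\<Gamma>\<^sub>0 y + sqrt s *\<^sub>R \<Gamma>\<^sub>1 y) \<le> M\<^sub>0 + M\<^sub>1" if "y \<in> cball X\<^sub>0 1" for y
    proof -
      have "norm (\<Gamma>\<^sub>0 y + sqrt s *\<^sub>R \<Gamma>\<^sub>1 y) \<le> norm (\<Gamma>\<^sub>0 y) + sqrt s * norm (\<Gamma>\<^sub>1 y)"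
        using norm_triangle_ineq[of "\<Gamma>\<^sub>0 y" "sqrt s *\<^sub>R \<Gamma>\<^sub>1 y"] s by simp
      also have "\<dots> \<le> M\<^sub>0 + 1 * M\<^sub>1"
        using M that s by (intro add_mono mult_mono) auto
      finally show ?thesis by simp
    qed
    moreover have "continuous_on (cball X\<^sub>0 1) (\<lambda>y. \<Gamma>\<^sub>0 y + sqrt s *\<^sub>R \<Gamma>\<^sub>1 y)"
      using assms by (intro continuous_intros) (auto intro: continuous_on_subset)
    moreover have "(M\<^sub>0 + M\<^sub>1) * sqrt s \<le> 1"
      using s(2) M(3,4) by (simp add: pos_less_divide_eq mult.commute less_imp_le)
    ultimately obtain X where "X 0 = X\<^sub>0"
      "\<And>t. t \<in> {0..sqrt s} \<Longrightarrow>
        (X has_vector_derivative \<Gamma>\<^sub>0 (X t) + sqrt s *\<^sub>R \<Gamma>\<^sub>1 (X t)) (at t within {0..sqrt s})"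
      using peano_ball[of X\<^sub>0 1 "\<lambda>y. \<Gamma>\<^sub>0 y + sqrt s *\<^sub>R \<Gamma>\<^sub>1 y" "M\<^sub>0 + M\<^sub>1" "sqrt s"]
        less_imp_le[OF s(1)] zero_le_one by blast
    then show ?thesis unfolding ode_solution_def by blast
  qed
  moreover have "\<forall>\<^sub>F s in at_right 0. 0 < sqrt s \<and> sqrt s < min 1 (1 / (M\<^sub>0 + M\<^sub>1))"
    using M by (intro eventually_sqrt_less) auto
  ultimately show ?thesis by (auto elim!: eventually_mono)
qed

text \<open>A first pass shows that
  \<open>X t - X\<^sub>0 - t *\<^sub>R \<Gamma>\<^sub>0 X\<^sub>0\<close> is of order
  \<open>\<tau>\<^sup>2\<close>; inserted into the linearised field, this determines the derivative
  of \<open>X\<close> up to o(\<tau>), and a second pass yields the expansion. The quantifier over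
  \<open>X\<close> stands inside the eventuality because the solution considered may change with
  \<open>s\<close>.\<close>

lemma ode_solution_expansion:
  fixes \<Gamma>\<^sub>0 \<Gamma>\<^sub>1 :: "'a::real_normed_vector \<Rightarrow> 'a"
  assumes \<Gamma>\<^sub>0: "(\<Gamma>\<^sub>0 has_derivative L) (at X\<^sub>0)" and \<Gamma>\<^sub>1: "isCont \<Gamma>\<^sub>1 X\<^sub>0" and "0 < e"
  shows "\<forall>\<^sub>F s in at_right 0. \<forall>X. ode_solution \<Gamma>\<^sub>0 \<Gamma>\<^sub>1 s X\<^sub>0 X \<longrightarrow>
    norm (X (sqrt s) - (X\<^sub>0 + sqrt s *\<^sub>R \<Gamma>\<^sub>0 X\<^sub>0 + s *\<^sub>R ((1 / 2) *\<^sub>R L (\<Gamma>\<^sub>0 X\<^sub>0) + \<Gamma>\<^sub>1 X\<^sub>0))) \<le> e * s"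
proof -
  \<comment> \<open>Near \<open>X\<^sub>0\<close>, \<open>K\<close> bounds
    \<open>\<Gamma>\<^sub>1\<close> and, for \<open>\<tau> \<le> 1\<close>, \<open>M\<close> bounds
    the full field.\<close>
  define K where "K = norm (\<Gamma>\<^sub>1 X\<^sub>0) + 1"
  define M where "M = norm (\<Gamma>\<^sub>0 X\<^sub>0) + 1 + K"
  have K: "1 \<le> K" and M: "1 \<le> M" by (auto simp: K_def M_def)
  interpret L: bounded_linear L using \<Gamma>\<^sub>0 by (rule has_derivative_bounded_linear)
  obtain C where C: "0 < C" "\<And>h. norm (L h) \<le> norm h * C"
    using L.pos_bounded by blast
  \<comment> \<open>The summands of \<open>D\<close> come from the linear part of
    \<open>\<Gamma>\<^sub>0\<close>, its linearisation error (with \<epsilon> at most 1) and the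
    perturbation \<open>\<Gamma>\<^sub>1\<close>.\<close>
  define D where "D = C * M + M + K"
  have D: "0 < D" using C K M by (simp add: D_def add_pos_pos)
  \<comment> \<open>In the second pass the linearisation error costs \<open>\<epsilon> * M\<close>
    and the oscillation of \<open>\<Gamma>\<^sub>1\<close> costs \<open>\<epsilon>\<close>, each
    times \<open>\<tau>\<close>; together they may use half of \<open>e\<close>.\<close>
  define \<epsilon> where "\<epsilon> = min 1 (e / (2 * (M + 1)))"
  have \<epsilon>: "0 < \<epsilon>" "\<epsilon> \<le> 1"
    using \<open>0 < e\<close> M by (auto simp: \<epsilon>_def)
  have "\<epsilon> \<le> e / (2 * (M + 1))" by (simp add: \<epsilon>_def)
  then have \<epsilon>_M: "\<epsilon> * (M + 1) \<le> e / 2"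
    using M by (simp add: field_simps)
  obtain d\<^sub>1 where "0 < d\<^sub>1"
    and d\<^sub>1': "\<forall>y. norm (y - X\<^sub>0) < d\<^sub>1 \<longrightarrow>
      norm (\<Gamma>\<^sub>0 y - \<Gamma>\<^sub>0 X\<^sub>0 - L (y - X\<^sub>0)) \<le> \<epsilon> * norm (y - X\<^sub>0)"
    using \<Gamma>\<^sub>0 \<epsilon>(1) unfolding has_derivative_within_alt by blast
  have d\<^sub>1: "norm (\<Gamma>\<^sub>0 y - \<Gamma>\<^sub>0 X\<^sub>0 - L (y - X\<^sub>0)) \<le> \<epsilon> * norm (y - X\<^sub>0)" if "dist X\<^sub>0 y < d\<^sub>1" for y
    using d\<^sub>1' that by (simp add: dist_norm norm_minus_commute[of X\<^sub>0])
  have "isCont \<Gamma>\<^sub>0 X\<^sub>0" using \<Gamma>\<^sub>0 by (rule has_derivative_continuous)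
  then obtain d\<^sub>2 where d\<^sub>2: "0 < d\<^sub>2" "\<And>y. dist X\<^sub>0 y < d\<^sub>2 \<Longrightarrow> norm (\<Gamma>\<^sub>0 y - \<Gamma>\<^sub>0 X\<^sub>0) < 1"
    unfolding continuous_at_eps_delta dist_norm by (metis norm_minus_commute zero_less_one)
  obtain d\<^sub>3 where d\<^sub>3: "0 < d\<^sub>3" "\<And>y. dist X\<^sub>0 y < d\<^sub>3 \<Longrightarrow> norm (\<Gamma>\<^sub>1 y - \<Gamma>\<^sub>1 X\<^sub>0) < \<epsilon>"
    using \<Gamma>\<^sub>1 \<epsilon>(1) unfolding continuous_at_eps_delta dist_norm by (metis norm_minus_commute)
  \<comment> \<open>Halving puts the closed ball of radius \<open>r\<close> inside all three open
    neighbourhoods.\<close>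
  define r where "r = min d\<^sub>1 (min d\<^sub>2 d\<^sub>3) / 2"
  have r: "0 < r" "r < d\<^sub>1" "r < d\<^sub>2" "r < d\<^sub>3" using \<open>0 < d\<^sub>1\<close> d\<^sub>2(1) d\<^sub>3(1) by (auto simp: r_def)
  \<comment> \<open>The three bounds give \<open>\<tau> \<le> 1\<close>, confinement to the ball of
    radius \<open>r\<close>, and \<open>C * D * \<tau> \<le> e / 2\<close> for the linear term of
    the second pass.\<close>
  define \<delta> where "\<delta> = min 1 (min (r / M) (e / (2 * C * D)))"
  have \<delta>: "0 < \<delta>" using r M C D \<open>0 < e\<close> by (simp add: \<delta>_def)
  have main: "norm (X \<tau> - (X\<^sub>0 + \<tau> *\<^sub>R \<Gamma>\<^sub>0 X\<^sub>0 + \<tau>\<^sup>2 *\<^sub>R ((1 / 2) *\<^sub>R L (\<Gamma>\<^sub>0 X\<^sub>0) + \<Gamma>\<^sub>1 X\<^sub>0))) \<le> e * \<tau>\<^sup>2"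
    if \<tau>: "0 < \<tau>" "\<tau> < \<delta>" and X0: "X 0 = X\<^sub>0"
      and X: "\<And>t. t \<in> {0..\<tau>} \<Longrightarrow>
        (X has_vector_derivative \<Gamma>\<^sub>0 (X t) + \<tau> *\<^sub>R \<Gamma>\<^sub>1 (X t)) (at t within {0..\<tau>})" for \<tau> X
  proof -
    have \<tau>': "\<tau> \<le> 1" "M * \<tau> < r" "C * D * \<tau> \<le> e / 2"
      using \<tau> M C D by (auto simp: \<delta>_def field_simps)
    have \<Gamma>\<^sub>1_le: "norm (\<Gamma>\<^sub>1 y) \<le> K" if "dist X\<^sub>0 y \<le> r" for y
      using d\<^sub>3(2)[of y] that r \<epsilon>(2) norm_triangle_sub[of "\<Gamma>\<^sub>1 y" "\<Gamma>\<^sub>1 X\<^sub>0"] by (auto simp: K_def)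
    have field_le: "norm (\<Gamma>\<^sub>0 y + \<tau> *\<^sub>R \<Gamma>\<^sub>1 y) \<le> M" if "dist X\<^sub>0 y \<le> r" for y
    proof -
      have "norm (\<Gamma>\<^sub>0 y) \<le> norm (\<Gamma>\<^sub>0 X\<^sub>0) + 1"
        using d\<^sub>2(2)[of y] that r norm_triangle_sub[of "\<Gamma>\<^sub>0 y" "\<Gamma>\<^sub>0 X\<^sub>0"] by auto
      moreover have "norm (\<tau> *\<^sub>R \<Gamma>\<^sub>1 y) \<le> 1 * K"
        unfolding norm_scaleR using \<tau> \<tau>' \<Gamma>\<^sub>1_le[OF that] by (intro mult_mono) auto
      ultimately show ?thesis
        using norm_triangle_ineq[of "\<Gamma>\<^sub>0 y" "\<tau> *\<^sub>R \<Gamma>\<^sub>1 y"] by (simp add: M_def)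
    qed
    have X_le: "norm (X t - X\<^sub>0) \<le> M * \<tau>" "dist X\<^sub>0 (X t) \<le> r" if "t \<in> {0..\<tau>}" for t
    proof -
      have "norm (X t - X\<^sub>0) \<le> M * t"
        using ode_a_priori_bound[where X = X and f = "\<lambda>y. \<Gamma>\<^sub>0 y + \<tau> *\<^sub>R \<Gamma>\<^sub>1 y",
            OF X0 X field_le _ r(1) \<tau>'(2) that] M
        by simp
      also have "\<dots> \<le> M * \<tau>" using that M by simp
      finally show "norm (X t - X\<^sub>0) \<le> M * \<tau>" .
      then show "dist X\<^sub>0 (X t) \<le> r" using \<tau>' by (simp add: dist_norm norm_minus_commute)
    qed
    have rem: "norm (\<Gamma>\<^sub>0 (X t) - \<Gamma>\<^sub>0 X\<^sub>0 - L (X t - X\<^sub>0)) \<le> \<epsilon> * (M * \<tau>)" if "t \<in> {0..\<tau>}" for t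
      using d\<^sub>1[of "X t"] X_le[OF that] r \<epsilon>(1)
      by (meson le_less_trans less_imp_le mult_left_mono order_trans)
    \<comment> \<open>First pass: near \<open>X\<^sub>0\<close> the field differs from
      \<open>\<Gamma>\<^sub>0 X\<^sub>0\<close> by at most \<open>D * \<tau>\<close>.\<close>
    have first: "norm (X u - X\<^sub>0 - u *\<^sub>R \<Gamma>\<^sub>0 X\<^sub>0) \<le> D * \<tau> * \<tau>" if u: "u \<in> {0..\<tau>}" for u
    proof -
      let ?g = "\<lambda>t. X t - X\<^sub>0 - t *\<^sub>R \<Gamma>\<^sub>0 X\<^sub>0"
      have "norm (?g u - ?g 0) \<le> D * \<tau> * u"
      proof (rule norm_diff_le_of_vector_derivative_bound)
        fix t assume t: "t \<in> {0..u}"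
        have "(X has_vector_derivative \<Gamma>\<^sub>0 (X t) + \<tau> *\<^sub>R \<Gamma>\<^sub>1 (X t)) (at t within {0..u})"
          using t u by (intro has_vector_derivative_within_subset[OF X]) auto
        then show "(?g has_vector_derivative \<Gamma>\<^sub>0 (X t) + \<tau> *\<^sub>R \<Gamma>\<^sub>1 (X t) - \<Gamma>\<^sub>0 X\<^sub>0) (at t within {0..u})"
          by (auto intro!: derivative_eq_intros)
      next
        fix t assume "0 < t" "t < u"
        then have t: "t \<in> {0..\<tau>}" using u by auto
        let ?a = "\<Gamma>\<^sub>0 (X t) - \<Gamma>\<^sub>0 X\<^sub>0 - L (X t - X\<^sub>0)" and ?b = "L (X t - X\<^sub>0)"
          and ?c = "\<tau> *\<^sub>R \<Gamma>\<^sub>1 (X t)"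
        have "norm ?a \<le> 1 * (M * \<tau>)"
          using rem[OF t] \<epsilon> M \<tau> by (elim order_trans) (intro mult_right_mono, auto)
        moreover have "norm ?b \<le> (M * \<tau>) * C"
          using C(2)[of "X t - X\<^sub>0"] X_le(1)[OF t] C(1)
          by (meson less_imp_le mult_right_mono order_trans)
        moreover have "norm ?c \<le> \<tau> * K"
          using \<Gamma>\<^sub>1_le[OF X_le(2)[OF t]] \<tau> by simp
        ultimately have "norm (?a + ?b + ?c) \<le> 1 * (M * \<tau>) + (M * \<tau>) * C + \<tau> * K"
          by (intro norm_triangle_mono)
        also have "\<dots> = D * \<tau>" by (simp add: D_def algebra_simps)
        finally show "norm (\<Gamma>\<^sub>0 (X t) + \<tau> *\<^sub>R \<Gamma>\<^sub>1 (X t) - \<Gamma>\<^sub>0 X\<^sub>0) \<le> D * \<tau>"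
          by (simp add: algebra_simps)
      qed (use u in simp)
      also have "D * \<tau> * u \<le> D * \<tau> * \<tau>" using u D \<tau> by simp
      finally show ?thesis by (simp add: X0)
    qed
    \<comment> \<open>The parameter \<open>\<tau>\<close> is frozen while \<open>t\<close> runs, so
      the perturbation integrates to \<open>t * \<tau>\<close>, whereas the linear term integrates
      to \<open>t\<^sup>2 / 2\<close>. At \<open>t = \<tau>\<close> only the latter keeps the factor
      1/2.\<close>
    let ?h = "\<lambda>t. X t - X\<^sub>0 - t *\<^sub>R \<Gamma>\<^sub>0 X\<^sub>0 - (t\<^sup>2 / 2) *\<^sub>R L (\<Gamma>\<^sub>0 X\<^sub>0) - (t * \<tau>) *\<^sub>R \<Gamma>\<^sub>1 X\<^sub>0"
    let ?h' = "\<lambda>t. \<Gamma>\<^sub>0 (X t) + \<tau> *\<^sub>R \<Gamma>\<^sub>1 (X t) - \<Gamma>\<^sub>0 X\<^sub>0 - t *\<^sub>R L (\<Gamma>\<^sub>0 X\<^sub>0) - \<tau> *\<^sub>R \<Gamma>\<^sub>1 X\<^sub>0"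
    have "norm (?h \<tau> - ?h 0) \<le> e * \<tau> * \<tau>"
    proof (rule norm_diff_le_of_vector_derivative_bound)
      fix t assume t: "t \<in> {0..\<tau>}"
      have "((\<lambda>t. t\<^sup>2 / 2) has_real_derivative t) (at t within {0..\<tau>})"
        "((\<lambda>t. t * \<tau>) has_real_derivative \<tau>) (at t within {0..\<tau>})"
        by (auto intro!: derivative_eq_intros)
      then show "(?h has_vector_derivative ?h' t) (at t within {0..\<tau>})"
        by (auto intro!: derivative_eq_intros X[OF t])
    next
      fix t assume "0 < t" "t < \<tau>"
      then have t: "t \<in> {0..\<tau>}" by auto
      \<comment> \<open>Second pass: \<open>?b\<close> is what is left of
        \<open>L (X t - X\<^sub>0)\<close> after subtracting
        \<open>t *\<^sub>R L (\<Gamma>\<^sub>0 X\<^sub>0)\<close>, and the first pass makes it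
        quadratic in \<open>\<tau>\<close>. It uses half of \<open>e\<close>; \<open>?a\<close> and
        \<open>?c\<close> share the other half.\<close>
      let ?a = "\<Gamma>\<^sub>0 (X t) - \<Gamma>\<^sub>0 X\<^sub>0 - L (X t - X\<^sub>0)" and ?b = "L (X t - X\<^sub>0 - t *\<^sub>R \<Gamma>\<^sub>0 X\<^sub>0)"
        and ?c = "\<tau> *\<^sub>R (\<Gamma>\<^sub>1 (X t) - \<Gamma>\<^sub>1 X\<^sub>0)"
      have "norm ?b \<le> (D * \<tau> * \<tau>) * C"
        using C(2)[of "X t - X\<^sub>0 - t *\<^sub>R \<Gamma>\<^sub>0 X\<^sub>0"] first[OF t] C(1)
        by (meson less_imp_le mult_right_mono order_trans)
      also have "\<dots> = (C * D * \<tau>) * \<tau>" by simp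
      also have "\<dots> \<le> e / 2 * \<tau>" using \<tau>' \<tau> by (intro mult_right_mono) auto
      finally have b: "norm ?b \<le> e / 2 * \<tau>" .
      have c: "norm ?c \<le> \<tau> * \<epsilon>"
        using d\<^sub>3(2)[of "X t"] X_le(2)[OF t] r \<tau> by auto
      have "\<epsilon> * (M * \<tau>) + \<tau> * \<epsilon> = \<epsilon> * (M + 1) * \<tau>" by (simp add: algebra_simps)
      also have "\<dots> \<le> e / 2 * \<tau>" using \<epsilon>_M \<tau> by (intro mult_right_mono) auto
      finally have ac: "\<epsilon> * (M * \<tau>) + \<tau> * \<epsilon> \<le> e / 2 * \<tau>" .
      have "?h' t = ?a + ?b + ?c" by (simp add: L.diff L.scaleR scaleR_diff_right)
      moreover have "norm (?a + ?b + ?c) \<le> \<epsilon> * (M * \<tau>) + e / 2 * \<tau> + \<tau> * \<epsilon>"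
        using rem[OF t] b c by (intro norm_triangle_mono)
      ultimately have "norm (?h' t) \<le> \<epsilon> * (M * \<tau>) + e / 2 * \<tau> + \<tau> * \<epsilon>" by (simp only:)
      also have "\<dots> \<le> e * \<tau>" using ac by simp
      finally show "norm (?h' t) \<le> e * \<tau>" .
    qed (use \<tau> in simp)
    then show ?thesis
      by (simp add: X0 power2_eq_square scaleR_add_right diff_diff_eq add.assoc mult.assoc)
  qed
  have "\<forall>\<^sub>F s in at_right 0. 0 < sqrt s \<and> sqrt s < \<delta>"
    using \<delta> by (rule eventually_sqrt_less)
  then show ?thesis
  proof (rule eventually_mono)
    fix s :: real assume s: "0 < sqrt s \<and> sqrt s < \<delta>"
    then show "\<forall>X. ode_solution \<Gamma>\<^sub>0 \<Gamma>\<^sub>1 s X\<^sub>0 X \<longrightarrow>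
      norm (X (sqrt s) - (X\<^sub>0 + sqrt s *\<^sub>R \<Gamma>\<^sub>0 X\<^sub>0 + s *\<^sub>R ((1 / 2) *\<^sub>R L (\<Gamma>\<^sub>0 X\<^sub>0) + \<Gamma>\<^sub>1 X\<^sub>0))) \<le> e * s"
      using main[of "sqrt s"] by (auto simp: ode_solution_def)
  qed
qed



section \<open>The heavy-ball template: expansion and relation to the iteration\<close>

text \<open>Only \<beta> is approximated; the gradient terms match exactly. The error is therefore a
  multiple of \<open>v\<close> in each component, made of the Taylor remainder of \<beta> and one
  cubic term.\<close>

lemma heavy_ball_template_expansion:
  fixes F :: "real ^ 'n \<Rightarrow> real" and x v :: "real ^ 'n"
  assumes \<beta>: "\<And>e. 0 < e \<Longrightarrow>
      \<forall>\<^sub>F \<tau> in at_right 0. \<bar>\<beta> \<tau> - (1 + \<tau> * \<beta>1 + \<tau>\<^sup>2 / 2 * \<beta>2)\<bar> \<le> e * \<tau>\<^sup>2"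
    and "0 < e"
  shows "\<forall>\<^sub>F \<tau> in at_right 0.
    norm (heavy_ball_template \<beta> F (x, v) \<tau>
      - ((x, v) + \<tau> *\<^sub>R (v, \<beta>1 *\<^sub>R v - gradient F x)
          + \<tau>\<^sup>2 *\<^sub>R (\<beta>1 *\<^sub>R v - gradient F x, (\<beta>2 / 2) *\<^sub>R v))) \<le> e * \<tau>\<^sup>2"
proof -
  \<comment> \<open>Adding 1 to the norm, and to \<open>\<bar>\<beta>2\<bar>\<close> below, keeps
    the denominators positive when \<open>v\<close> or \<open>\<beta>2\<close> vanishes.\<close>
  define V where "V = norm v + 1"
  have V: "norm v \<le> V" "0 < V" by (auto simp: V_def add_nonneg_pos)
  define \<delta> where "\<delta> = min 1 (e / (2 * V * (\<bar>\<beta>2\<bar> + 1)))"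
  have \<delta>: "0 < \<delta>" using \<open>0 < e\<close> V by (simp add: \<delta>_def add_nonneg_pos)
  have "\<forall>\<^sub>F \<tau> in at_right 0. 0 < \<tau> \<and> \<tau> < \<delta>"
    using \<delta> by (intro eventually_at_rightI[of 0 \<delta>]) auto
  moreover have "\<forall>\<^sub>F \<tau> in at_right 0.
      \<bar>\<beta> \<tau> - (1 + \<tau> * \<beta>1 + \<tau>\<^sup>2 / 2 * \<beta>2)\<bar> \<le> e / (4 * V) * \<tau>\<^sup>2"
    using \<open>0 < e\<close> V by (intro \<beta>) simp
  ultimately show ?thesis
  proof eventually_elim
    case (elim \<tau>)
    define r where "r = \<beta> \<tau> - (1 + \<tau> * \<beta>1 + \<tau>\<^sup>2 / 2 * \<beta>2)"
    have \<tau>: "0 < \<tau>" "\<tau> < 1" "\<tau> \<le> e / (2 * V * (\<bar>\<beta>2\<bar> + 1))" using elim(1) by (auto simp: \<delta>_def)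
    have \<beta>_eq: "\<beta> \<tau> = r + 1 + \<tau> * \<beta>1 + \<tau>\<^sup>2 / 2 * \<beta>2" by (simp add: r_def)
    have r: "\<bar>r\<bar> * V \<le> e / 4 * \<tau>\<^sup>2"
      using mult_right_mono[OF elim(2), of V] V by (simp add: r_def)
    have "\<tau> * (V * (\<bar>\<beta>2\<bar> + 1)) \<le> e / 2"
    proof -
      have "0 < 2 * V * (\<bar>\<beta>2\<bar> + 1)" using V by (simp add: add_nonneg_pos)
      then have "\<tau> * (2 * V * (\<bar>\<beta>2\<bar> + 1)) \<le> e" using \<tau>(3) pos_le_divide_eq by blast
      then show ?thesis by simp
    qed
    then have "\<tau> * (V * (\<bar>\<beta>2\<bar> + 1)) * \<tau>\<^sup>2 \<le> e / 2 * \<tau>\<^sup>2"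
      by (rule mult_right_mono) simp
    moreover have "\<tau> * (V * \<bar>\<beta>2\<bar>) * \<tau>\<^sup>2 \<le> \<tau> * (V * (\<bar>\<beta>2\<bar> + 1)) * \<tau>\<^sup>2"
      using \<tau> V by (intro mult_right_mono mult_left_mono) auto
    ultimately have b2: "\<tau> * (V * \<bar>\<beta>2\<bar>) * \<tau>\<^sup>2 \<le> e / 2 * \<tau>\<^sup>2" by linarith
    have eq: "heavy_ball_template \<beta> F (x, v) \<tau>
      - ((x, v) + \<tau> *\<^sub>R (v, \<beta>1 *\<^sub>R v - gradient F x)
          + \<tau>\<^sup>2 *\<^sub>R (\<beta>1 *\<^sub>R v - gradient F x, (\<beta>2 / 2) *\<^sub>R v))
      = ((\<tau> * r + \<tau> * \<tau>\<^sup>2 / 2 * \<beta>2) *\<^sub>R v, r *\<^sub>R v)"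
      by (simp add: heavy_ball_template_def \<beta>_eq power2_eq_square algebra_simps)
    have "\<bar>\<tau> * r + \<tau> * \<tau>\<^sup>2 / 2 * \<beta>2\<bar> \<le> \<bar>\<tau> * r\<bar> + \<bar>\<tau> * \<tau>\<^sup>2 / 2 * \<beta>2\<bar>" by (rule abs_triangle_ineq)
    also have "\<dots> \<le> \<bar>r\<bar> + \<tau> * \<tau>\<^sup>2 / 2 * \<bar>\<beta>2\<bar>"
      using \<tau> by (simp add: abs_mult mult_left_le_one_le)
    finally have "norm ((\<tau> * r + \<tau> * \<tau>\<^sup>2 / 2 * \<beta>2) *\<^sub>R v) \<le> (\<bar>r\<bar> + \<tau> * \<tau>\<^sup>2 / 2 * \<bar>\<beta>2\<bar>) * V"
      unfolding norm_scaleR using V \<tau> by (intro mult_mono) auto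
    also have "\<dots> = \<bar>r\<bar> * V + \<tau> * (V * \<bar>\<beta>2\<bar>) * \<tau>\<^sup>2 / 2" by (simp add: algebra_simps)
    finally have "norm ((\<tau> * r + \<tau> * \<tau>\<^sup>2 / 2 * \<beta>2) *\<^sub>R v) \<le> e / 2 * \<tau>\<^sup>2"
      using r b2 by simp
    moreover have "norm (r *\<^sub>R v) \<le> \<bar>r\<bar> * V"
      unfolding norm_scaleR using V by (intro mult_left_mono) auto
    moreover have "0 \<le> e * \<tau>\<^sup>2" using \<open>0 < e\<close> by simp
    \<comment> \<open>Budget in multiples of \<open>e * \<tau>\<^sup>2\<close>: one quarter for the
      remainder in each component and one quarter for the cubic term.\<close>
    ultimately have "norm ((\<tau> * r + \<tau> * \<tau>\<^sup>2 / 2 * \<beta>2) *\<^sub>R v) + norm (r *\<^sub>R v) \<le> e * \<tau>\<^sup>2"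
      using r by simp
    then show ?case
      unfolding eq by (rule order_trans[OF norm_Pair_le])
  qed
qed

text \<open>The template's new position is the old one plus \<open>sqrt s\<close> times its new
  velocity \<open>?w\<close>. Since \<open>sqrt s\<close> is nonzero, the position and velocity
  equations are equivalent, and the former is the iteration step.\<close>

lemma heavy_ball_iteration_iff_template:
  fixes F :: "real ^ 'n \<Rightarrow> real"
  assumes "0 < s"
  shows "heavy_ball_iteration \<beta> F s x \<longleftrightarrow>
    (\<forall>k\<ge>1. heavy_ball_state s x (k + 1) =
      heavy_ball_template \<beta> F (heavy_ball_state s x k) (sqrt s))"
proof -
  have s: "sqrt s * sqrt s = s" "sqrt s \<noteq> 0" using assms by auto
  have "x (k + 1) = x k + \<beta> (sqrt s) *\<^sub>R (x k - x (k - 1)) - s *\<^sub>R gradient F (x k) \<longleftrightarrow>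
      heavy_ball_state s x (k + 1) = heavy_ball_template \<beta> F (heavy_ball_state s x k) (sqrt s)"
    (is "?it \<longleftrightarrow> ?st") for k
  proof -
    let ?w = "\<beta> (sqrt s) *\<^sub>R ((x k - x (k - 1)) /\<^sub>R sqrt s) - sqrt s *\<^sub>R gradient F (x k)"
    have w: "sqrt s *\<^sub>R ?w = \<beta> (sqrt s) *\<^sub>R (x k - x (k - 1)) - s *\<^sub>R gradient F (x k)"
    proof -
      have "sqrt s *\<^sub>R (\<beta> (sqrt s) *\<^sub>R ((x k - x (k - 1)) /\<^sub>R sqrt s))
          = (\<beta> (sqrt s) * (sqrt s * inverse (sqrt s))) *\<^sub>R (x k - x (k - 1))"
        by (simp only: scaleR_scaleR mult_ac)
      then show ?thesis
        using s right_inverse[OF s(2)] by (simp only: scaleR_diff_right scaleR_scaleR mult_1_right)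
    qed
    have "?st \<longleftrightarrow> x (k + 1) = x k + sqrt s *\<^sub>R ?w \<and> (x (k + 1) - x k) /\<^sub>R sqrt s = ?w"
      by (simp add: heavy_ball_state_def heavy_ball_template_def)
    also have "\<dots> \<longleftrightarrow> x (k + 1) = x k + sqrt s *\<^sub>R ?w"
      using s(2) by (metis add_diff_cancel_left' divideR_right)
    finally show ?thesis unfolding w by (simp add: algebra_simps)
  qed
  then show ?thesis by (simp only: heavy_ball_iteration_def)
qed

section \<open>Matching the expansions of solution and template\<close>

theorem theorem3p2:
  fixes F :: "real ^ 'n \<Rightarrow> real" and \<beta> :: "real \<Rightarrow> real" and \<tau>\<^sub>0 :: real
  assumes "twice_continuously_differentiable F"
    and "\<tau>\<^sub>0 > 0"
    and "smooth_within {0..<\<tau>\<^sub>0} \<beta>"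
    and "((\<lambda>s. \<beta> (sqrt s)) \<longlongrightarrow> 1) (at_right 0)"
  shows "(\<forall>s>0. \<forall>x.
            heavy_ball_iteration \<beta> F s x \<longleftrightarrow>
            (\<forall>k\<ge>1. heavy_ball_state s x (k + 1) =
                    heavy_ball_template \<beta> F (heavy_ball_state s x k) (sqrt s))) \<and>
         (let \<beta>1 = higher_deriv_within {0..<\<tau>\<^sub>0} \<beta> 1 0;
              \<beta>2 = higher_deriv_within {0..<\<tau>\<^sub>0} \<beta> 2 0
          in sqrt_s_resolution_ode (heavy_ball_template \<beta> F)
               (\<lambda>(x, v). (v, \<beta>1 *\<^sub>R v - gradient F x))
               (\<lambda>(x, v). (1 / 2) *\<^sub>R
                  (\<beta>1 *\<^sub>R v - gradient F x,
                   (\<beta>2 - \<beta>1\<^sup>2) *\<^sub>R v + hessian F x *v v + \<beta>1 *\<^sub>R gradient F x)))"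
proof -
  let ?S = "{0..<\<tau>\<^sub>0}"
  define \<beta>1 where "\<beta>1 = higher_deriv_within ?S \<beta> 1 0"
  define \<beta>2 where "\<beta>2 = higher_deriv_within ?S \<beta> 2 0"
  define \<Gamma>\<^sub>0 :: "(real ^ 'n) \<times> (real ^ 'n) \<Rightarrow> (real ^ 'n) \<times> (real ^ 'n)"
    where "\<Gamma>\<^sub>0 = (\<lambda>(x, v). (v, \<beta>1 *\<^sub>R v - gradient F x))"
  define \<Gamma>\<^sub>1 :: "(real ^ 'n) \<times> (real ^ 'n) \<Rightarrow> (real ^ 'n) \<times> (real ^ 'n)"
    where "\<Gamma>\<^sub>1 = (\<lambda>(x, v). (1 / 2) *\<^sub>R (\<beta>1 *\<^sub>R v - gradient F x,
      (\<beta>2 - \<beta>1\<^sup>2) *\<^sub>R v + hessian F x *v v + \<beta>1 *\<^sub>R gradient F x))"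

  have \<beta>_deriv: "(higher_deriv_within ?S \<beta> n has_vector_derivative higher_deriv_within ?S \<beta> (Suc n) t)
      (at t within ?S)" if "t \<in> ?S" for n t
    using assms(3) that by (simp add: smooth_within_def vector_derivative_works[symmetric])
  have at0: "at 0 within ?S = at_right 0"
    using \<open>0 < \<tau>\<^sub>0\<close> by (intro at_within_nhd[of _ "{..<\<tau>\<^sub>0}"]) auto
  \<comment> \<open>The assumption concerns only the limit of \<beta>; one-sided continuity at 0
    turns it into \<open>\<beta> 0 = 1\<close>, the constant term of the Taylor expansion and the
    reason for the template being the identity at 0.\<close>
  have "(\<beta> \<longlongrightarrow> \<beta> 0) (at_right 0)"
    using has_vector_derivative_continuous[OF \<beta>_deriv[of 0 0]] \<open>0 < \<tau>\<^sub>0\<close>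
    by (simp add: continuous_within at0)
  then have "((\<lambda>s. \<beta> (sqrt s)) \<longlongrightarrow> \<beta> 0) (at_right 0)"
    using filterlim_sqrt_at_right_0 by (rule filterlim_compose)
  then have \<beta>0: "\<beta> 0 = 1"
    using assms(4) tendsto_unique[of "at_right (0::real)"] by simp
  have \<beta>_expansion: "\<forall>\<^sub>F \<tau> in at_right 0. \<bar>\<beta> \<tau> - (1 + \<tau> * \<beta>1 + \<tau>\<^sup>2 / 2 * \<beta>2)\<bar> \<le> e * \<tau>\<^sup>2"
    if "0 < e" for e
    using taylor_2_at_right_0[OF \<open>0 < \<tau>\<^sub>0\<close> \<beta>_deriv[of _ 0] \<beta>_deriv[of 0 "Suc 0"] that] \<open>0 < \<tau>\<^sub>0\<close>
    by (simp add: \<beta>0 \<beta>1_def \<beta>2_def numeral_2_eq_2)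

  have grad: "(gradient F has_derivative (\<lambda>h. hessian F x *v h)) (at x)" for x
    using assms(1) unfolding twice_continuously_differentiable_def hessian_def jacobian_works[symmetric]
    by blast
  have cont_grad: "continuous_on UNIV (gradient F)"
    using grad has_derivative_continuous continuous_at_imp_continuous_on by blast
  have cont_hess: "continuous_on UNIV (hessian F)"
    using assms(1) by (simp add: twice_continuously_differentiable_def)
  have cont_grad': "continuous_on UNIV (\<lambda>z :: (real ^ 'n) \<times> (real ^ 'n). gradient F (fst z))"
    by (rule continuous_on_compose2[OF cont_grad]) (auto intro: continuous_intros)
  have cont_hess': "continuous_on UNIV (\<lambda>z :: (real ^ 'n) \<times> (real ^ 'n). hessian F (fst z))"
    by (rule continuous_on_compose2[OF cont_hess]) (auto intro: continuous_intros)
  have cont\<^sub>0: "continuous_on UNIV \<Gamma>\<^sub>0"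
    unfolding \<Gamma>\<^sub>0_def case_prod_unfold by (intro continuous_intros cont_grad')
  have cont\<^sub>1: "continuous_on UNIV \<Gamma>\<^sub>1"
    unfolding \<Gamma>\<^sub>1_def case_prod_unfold
    by (intro continuous_intros cont_grad' continuous_on_matrix_vector_mult cont_hess')

  have "sqrt_s_resolution_ode (heavy_ball_template \<beta> F) \<Gamma>\<^sub>0 \<Gamma>\<^sub>1"
    unfolding sqrt_s_resolution_ode_def
  proof (intro conjI allI impI)
    show "heavy_ball_template \<beta> F X\<^sub>0 0 = X\<^sub>0" for X\<^sub>0
      by (simp add: heavy_ball_template_def \<beta>0 split: prod.split)
    show "\<forall>\<^sub>F s in at_right 0. \<exists>X. ode_solution \<Gamma>\<^sub>0 \<Gamma>\<^sub>1 s X\<^sub>0 X" for X\<^sub>0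
      by (rule eventually_ode_solution_exists[OF cont\<^sub>0 cont\<^sub>1])
    fix X\<^sub>0 :: "(real ^ 'n) \<times> (real ^ 'n)" and X
    assume X: "\<forall>\<^sub>F s in at_right 0. ode_solution \<Gamma>\<^sub>0 \<Gamma>\<^sub>1 s X\<^sub>0 (X s)"
    obtain x v where X\<^sub>0: "X\<^sub>0 = (x, v)" by (cases X\<^sub>0)
    \<comment> \<open>Derivative of \<open>\<Gamma>\<^sub>0\<close> at \<open>X\<^sub>0\<close>: the
      Hessian acts on the position increment. Applied to \<open>\<Gamma>\<^sub>0 X\<^sub>0\<close>,
      whose position component is \<open>v\<close>, it produces the Hessian term in
      \<open>v\<close>.\<close>
    define L where "L = (\<lambda>h. (snd h, \<beta>1 *\<^sub>R snd h - hessian F x *v fst h))"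
    have L: "(\<Gamma>\<^sub>0 has_derivative L) (at X\<^sub>0)"
    proof -
      have "((\<lambda>z. gradient F (fst z)) has_derivative (\<lambda>h. hessian F x *v fst h)) (at X\<^sub>0)"
        by (rule has_derivative_compose[of fst fst]) (auto intro: derivative_intros simp: X\<^sub>0 grad)
      then show ?thesis
        unfolding \<Gamma>\<^sub>0_def L_def case_prod_unfold by (auto intro!: derivative_intros)
    qed
    define Q where "Q = (1 / 2) *\<^sub>R L (\<Gamma>\<^sub>0 X\<^sub>0) + \<Gamma>\<^sub>1 X\<^sub>0"
    \<comment> \<open>The choice of \<open>\<Gamma>\<^sub>1\<close> makes the Hessian cancel against the derivative of \<open>\<Gamma>\<^sub>0\<close>.\<close>
    have Q: "Q = (\<beta>1 *\<^sub>R v - gradient F x, (\<beta>2 / 2) *\<^sub>R v)"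
    proof -
      let ?w = "\<beta>1 *\<^sub>R v - gradient F x"
      have "(\<beta>1 *\<^sub>R ?w - hessian F x *v v)
          + ((\<beta>2 - \<beta>1\<^sup>2) *\<^sub>R v + hessian F x *v v + \<beta>1 *\<^sub>R gradient F x) = \<beta>2 *\<^sub>R v"
        by (simp add: algebra_simps power2_eq_square)
      then have "(1 / 2) *\<^sub>R (\<beta>1 *\<^sub>R ?w - hessian F x *v v)
          + (1 / 2) *\<^sub>R ((\<beta>2 - \<beta>1\<^sup>2) *\<^sub>R v + hessian F x *v v + \<beta>1 *\<^sub>R gradient F x)
          = (\<beta>2 / 2) *\<^sub>R v"
        unfolding scaleR_add_right[symmetric] by simp
      moreover have "(1 / 2) *\<^sub>R ?w + (1 / 2) *\<^sub>R ?w = ?w"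
        unfolding scaleR_add_left[symmetric] by simp
      ultimately show ?thesis
        by (simp only: Q_def L_def \<Gamma>\<^sub>0_def \<Gamma>\<^sub>1_def X\<^sub>0 prod.case fst_conv snd_conv scaleR_Pair add_Pair)
    qed
    show "(\<lambda>s. norm (X s (sqrt s) - heavy_ball_template \<beta> F X\<^sub>0 (sqrt s))) \<in> o[at_right 0](\<lambda>s. s)"
    proof (rule landau_o.smallI)
      fix c :: real assume "0 < c"
      then have c: "0 < c / 2" by simp
      have "isCont \<Gamma>\<^sub>1 X\<^sub>0" using cont\<^sub>1 continuous_on_eq_continuous_at open_UNIV by blast
      note ode_solution_expansion[OF L this c]
      \<comment> \<open>Substitution of \<open>sqrt s\<close> for \<tau> in the template expansion,
        whose quadratic coefficient is exactly \<open>Q\<close>.\<close>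
      moreover have "\<forall>\<^sub>F s in at_right 0. norm (heavy_ball_template \<beta> F X\<^sub>0 (sqrt s)
          - (X\<^sub>0 + sqrt s *\<^sub>R \<Gamma>\<^sub>0 X\<^sub>0 + (sqrt s)\<^sup>2 *\<^sub>R Q)) \<le> c / 2 * (sqrt s)\<^sup>2"
        using eventually_compose_filterlim[OF heavy_ball_template_expansion[OF \<beta>_expansion c]
            filterlim_sqrt_at_right_0]
        unfolding Q by (simp add: X\<^sub>0 \<Gamma>\<^sub>0_def)
      moreover have "\<forall>\<^sub>F s in at_right (0::real). 0 < s"
        by (rule eventually_at_right_less)
      ultimately show "\<forall>\<^sub>F s in at_right 0.
          norm (norm (X s (sqrt s) - heavy_ball_template \<beta> F X\<^sub>0 (sqrt s))) \<le> c * norm s"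
        using X
      proof eventually_elim
        case (elim s)
        \<comment> \<open>Solution and template share this second-order polynomial, and each lies
          within \<open>c / 2 * s\<close> of it.\<close>
        let ?p = "X\<^sub>0 + sqrt s *\<^sub>R \<Gamma>\<^sub>0 X\<^sub>0 + s *\<^sub>R Q"
        have "dist (X s (sqrt s)) ?p \<le> c / 2 * s"
          using elim(1,4) by (simp add: Q_def dist_norm)
        moreover have "dist (heavy_ball_template \<beta> F X\<^sub>0 (sqrt s)) ?p \<le> c / 2 * s"
          using elim(2,3) by (simp add: dist_norm)
        ultimately have "dist (X s (sqrt s)) (heavy_ball_template \<beta> F X\<^sub>0 (sqrt s)) \<le> c / 2 * s + c / 2 * s"
          by (rule dist_triangle_le[OF add_mono])
        then show ?case using elim(3) by (simp add: dist_norm)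
      qed
    qed
  qed
  then show ?thesis
    unfolding Let_def \<Gamma>\<^sub>0_def \<Gamma>\<^sub>1_def \<beta>1_def \<beta>2_def
    by (intro conjI allI impI heavy_ball_iteration_iff_template)
qed

end
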